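(* Let $G(\mathfrak{z};\alpha)=C(\alpha)(\mathfrak{z}I-A(\alpha))^{-1}B(\alpha)+D(\alpha)$ with $A(\alpha)\in\mathbb{R}[\alpha]^{n\times n}$, $B(\alpha)\in\mathbb{R}[\alpha]^{n\times m}$, $C(\alpha)\in\mathbb{R}[\alpha]^{o\times n}$, $D(\alpha)\in\mathbb{R}[\alpha]^{o\times m}$ be a parameter-dependent discrete-time linear system with parameter vector $\alpha\in\mathbb{R}^p$. Assume that the compact set $\mathcal{A}\subset\mathbb{R}^p$ of eligible parameters can be characterized as $$\mathcal{A}=\left\{\alpha\in\mathbb{R}^{p} \;|\; q_\ell(\alpha)\geq 0,\ \forall\, 1\leq \ell \leq L \right\},$$ where $q_\ell\in\mathbb{R}[\alpha]$ for all $1\leq \ell\leq L$. Furthermore, assume that there exist $w_\ell\in\mathcal{S}[\alpha]$ for all $0\leq \ell\leq L$ such that $\{\alpha\in\mathbb{R}^{p}\;|\; w_0(\alpha)+\sum_{\ell=1}^L q_\ell(\alpha)w_\ell(\alpha)\geq 0\}$ is a compact set. Let $\gamma\in\mathbb{R}_{\geq 0}$, and fix a reduced system $G'(\mathfrak{z};\alpha')=C'(\alpha')(\mathfrak{z}I-A'(\alpha'))^{-1}B'(\alpha')+D'(\alpha')$ with $A'(\alpha')\in\mathbb{R}[\alpha']^{n'\times n'}$, $B'(\alpha')\in\mathbb{R}[\alpha']^{n'\times m}$, $C'(\alpha')\in\mathbb{R}[\alpha']^{o\times n'}$, $D'(\alpha')\in\mathbb{R}[\alpha']^{o\times m}$,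 where $\alpha'=T(\alpha)=[\alpha_1\ \cdots\ \alpha_{p'}]^\top$ and $p'\leq p$. Define $$\tilde{A}(\alpha)=\begin{bmatrix}A(\alpha) & 0\\ 0 & A'(\alpha')\end{bmatrix},\quad \tilde{B}(\alpha)=\begin{bmatrix}B(\alpha)\\ B'(\alpha')\end{bmatrix},\quad \tilde{C}(\alpha)=\begin{bmatrix}C(\alpha) & -C'(\alpha')\end{bmatrix},\quad \tilde{D}(\alpha)=D(\alpha)-D'(\alpha').$$ If there exist a constant $\epsilon\in\mathbb{R}_{>0}$ and polynomial matrices $P(\alpha)\in\mathcal{S}[\alpha]^{n+n'}$ and $Q_\ell(\alpha)\in\mathcal{S}[\alpha]^{2(n+n')+m+o}$ for all $0\leq \ell\leq L$ such that the polynomial matrix identity $$\begin{bmatrix}P(\alpha) & \tilde{A}(\alpha)P(\alpha) & \tilde{B}(\alpha) & 0\\ P(\alpha)\tilde{A}(\alpha)^\top & P(\alpha) & 0 & P(\alpha)\tilde{C}(\alpha)^\top\\ \tilde{B}(\alpha)^\top & 0 & I & \tilde{D}(\alpha)^\top\\ 0 & \tilde{C}(\alpha)P(\alpha) & \tilde{D}(\alpha) & \gamma^2 I\end{bmatrix}-\epsilon I-Q_0(\alpha)-\sum_{\ell=1}^L Q_\ell(\alpha)q_\ell(\alpha)=0$$ holds, then $\|G(\mathfrak{z};\alpha)-G'(\mathfrak{z};T(\alpha))\|_\infty\leq\gamma$ for all $\alpha\in\mathcal{A}$.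
   Context: $\mathbb{R}[\alpha]$ is the ring of real polynomials in the entries of $\alpha=(\alpha_1,\dots,\alpha_p)$, and $\mathbb{R}[\alpha]^{k\times l}$ is the set of $k\times l$ matrices with entries in $\mathbb{R}[\alpha]$. $\mathcal{S}[\alpha]^k$ is the set of sum-of-squares matrices, i.e. those $X(\alpha)\in\mathbb{R}[\alpha]^{k\times k}$ for which there exists $Y(\alpha)\in\mathbb{R}[\alpha]^{k\times k}$ with $X(\alpha)=Y(\alpha)^\top Y(\alpha)$; $\mathcal{S}[\alpha]=\mathcal{S}[\alpha]^1$. The dimensions $n,n',m,o,p,p'$ are natural numbers ($n,n'$: state dimensions; $m$: inputs; $o$: outputs). For each fixed $\alpha$, $G(\mathfrak{z};\alpha)-G'(\mathfrak{z};T(\alpha))$ is the transfer function $\tilde C(\alpha)(\mathfrak{z}I-\tilde A(\alpha))^{-1}\tilde B(\alpha)+\tilde D(\alpha)$ of a discrete-time linear time-invariant system, and $\|\cdot\|_\infty$ is the usual discrete-time $H_\infty$-norm (the supremum over $|\mathfrak{z}|>1$ of the largest singular value of the transfer matrix). *)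

theory Defs
  imports
    "HOL-Library.Poly_Mapping"
    "HOL-Library.Extended_Real"
    "HOL-Analysis.Abstract_Euclidean_Space"
    "Jordan_Normal_Form.Spectral_Radius"
begin

text \<open>
  Real polynomials in the variables with indices \<open>0, 1, 2, \<dots>\<close>: finitely supported maps from monomials
  (finitely supported exponent maps) to coefficients.
\<close>

type_synonym mpoly = "(nat \<Rightarrow>\<^sub>0 nat) \<Rightarrow>\<^sub>0 real"

definition Const :: "real \<Rightarrow> mpoly" where
  "Const c = Poly_Mapping.single 0 c"

definition eval_mpoly :: "(nat \<Rightarrow> real) \<Rightarrow> mpoly \<Rightarrow> real" where
  "eval_mpoly \<alpha> f =
     (\<Sum>u\<in>Poly_Mapping.keys f. Poly_Mapping.lookup f u *
        (\<Prod>i\<in>Poly_Mapping.keys u. \<alpha> i ^ Poly_Mapping.lookup u i))"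

text \<open>
  The ring of polynomials in the first \<open>p\<close> variables; for \<open>p' \<le> p\<close>, \<open>polys p' \<subseteq> polys p\<close>
  is the inclusion of the polynomials in the first \<open>p'\<close> variables.
\<close>

definition polys :: "nat \<Rightarrow> mpoly set" where
  "polys p = {f. \<forall>u\<in>Poly_Mapping.keys f. Poly_Mapping.keys u \<subseteq> {..<p}}"

definition poly_mats :: "nat \<Rightarrow> nat \<Rightarrow> nat \<Rightarrow> mpoly mat set" where
  "poly_mats p k l = {M \<in> carrier_mat k l. elements_mat M \<subseteq> polys p}"

definition sos_mats :: "nat \<Rightarrow> nat \<Rightarrow> mpoly mat set" where
  "sos_mats p k = {X \<in> poly_mats p k k. \<exists>Y\<in>poly_mats p k k. X = transpose_mat Y * Y}"

definition sos :: "nat \<Rightarrow> mpoly set" where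
  "sos p = {w. mat 1 1 (\<lambda>_. w) \<in> sos_mats p 1}"

text \<open>
  Points of \<open>\<real>\<^sup>p\<close> are the elements of \<^term>\<open>topspace (Euclidean_space p)\<close>: real sequences that vanish
  from index \<open>p\<close> on.  \<open>trunc p'\<close> keeps the first \<open>p'\<close> coordinates.
\<close>

definition trunc :: "nat \<Rightarrow> (nat \<Rightarrow> real) \<Rightarrow> nat \<Rightarrow> real" where
  "trunc p' \<alpha> = (\<lambda>i. if i < p' then \<alpha> i else 0)"

definition eval_cmat :: "(nat \<Rightarrow> real) \<Rightarrow> mpoly mat \<Rightarrow> complex mat" where
  "eval_cmat \<alpha> = map_mat (\<lambda>f. complex_of_real (eval_mpoly \<alpha> f))"

definition mat_sum :: "nat \<Rightarrow> nat \<Rightarrow> ('i \<Rightarrow> 'a::comm_monoid_add mat) \<Rightarrow> 'i set \<Rightarrow> 'a mat" where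
  "mat_sum k l F I = mat k l (\<lambda>ij. \<Sum>x\<in>I. F x $$ ij)"

text \<open>Meaningful off the eigenvalues of \<open>A\<close> only; there the inverse exists.\<close>

definition transfer_fun ::
  "complex mat \<Rightarrow> complex mat \<Rightarrow> complex mat \<Rightarrow> complex mat \<Rightarrow> complex \<Rightarrow> complex mat" where
  "transfer_fun A B C D z =
     C * the (mat_inverse (z \<cdot>\<^sub>m 1\<^sub>m (dim_row A) - A)) * B + D"

text \<open>
  The singular values are the square roots of the (real, nonnegative) eigenvalues of \<open>M\<^sup>* M\<close>;
  inserting \<open>0\<close> matters only for a matrix without columns.
\<close>

definition largest_singular_value :: "complex mat \<Rightarrow> real" where
  "largest_singular_value M =
     Max (insert 0 ((\<lambda>x. sqrt (Re x)) ` spectrum (mat_adjoint M * M)))"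

text \<open>
  The norm of a rational matrix function \<open>F\<close> given by a formula that is valid off the finite set \<open>\<Lambda>\<close>,
  with values in the extended reals.  Leaving out \<open>\<Lambda>\<close> does not change the supremum: at a removable
  singularity the value of \<open>F\<close> is the limit of values nearby, and near a pole in \<open>|z| > 1\<close> the
  largest singular value is unbounded, so that the norm is \<open>\<infinity>\<close>.
\<close>

definition hinf_norm :: "complex set \<Rightarrow> (complex \<Rightarrow> complex mat) \<Rightarrow> ereal" where
  "hinf_norm \<Lambda> F = (SUP z\<in>{z. cmod z > 1} - \<Lambda>. ereal (largest_singular_value (F z)))"

end

(*
  If z x = A x + B u and y = C x + D u, write x = P v (P is positive definite by the certificate) and
  test the block matrix with the vector (-z v, v, u, -t y), t real. This gives
    0 <= (1 - |z|^2) (v^* P v) + |u|^2 - 2 t |y|^2 + gamma^2 t^2 |y|^2.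
  For |z| > 1 the first term is nonpositive; optimizing over t yields |y| <= gamma |u|.
*)
theory Submission
  imports Defs
begin

text \<open>The test vector is what minimising the form block by block, as Schur complements would,
  produces. With second entry v and third entry u, the terms in the first entry a are a^* P a + 2 Re
  a^*(A x + B u) = a^* P a + 2 Re a^*(z x), least at P a = -z x. The terms in the last entry d are
  \<gamma>^2 |d|^2 + 2 Re d^* y, least at d = -y/\<gamma>^2. For \<gamma> = 0 the latter minimiser
  does not exist, which is why t stays free: large t then forces y = 0. The certificate is an
  identity between real polynomials, whereas z, and with it the test vector, is complex. Evaluation
  therefore goes into complex matrices that are fixed by entrywise conjugation; for these the
  transpose is the adjoint, and a sum-of-squares matrix yields a nonnegative Hermitian form. The
  estimate is made for one z at a time. Off the spectra of A and A' each resolvent is traded for a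
  state, and the two states, driven by the same input, are stacked.\<close>

section \<open>Evaluation of polynomials as a ring homomorphism\<close>

definition eval_monom :: "(nat \<Rightarrow> real) \<Rightarrow> (nat \<Rightarrow>\<^sub>0 nat) \<Rightarrow> real" where
  "eval_monom \<alpha> u = (\<Prod>i\<in>Poly_Mapping.keys u. \<alpha> i ^ Poly_Mapping.lookup u i)"

text \<open>Indices outside the keys have exponent \<open>0\<close> and contribute the factor
  \<open>1\<close>. Padding to a common index set allows two monomials to be compared factor by
  factor.\<close>

lemma eval_monom_superset:
  assumes "finite S" "Poly_Mapping.keys u \<subseteq> S"
  shows "eval_monom \<alpha> u = (\<Prod>i\<in>S. \<alpha> i ^ Poly_Mapping.lookup u i)"
  unfolding eval_monom_def using assms
  by (intro prod.mono_neutral_left) (auto simp: in_keys_iff)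

lemma eval_monom_add: "eval_monom \<alpha> (u + v) = eval_monom \<alpha> u * eval_monom \<alpha> v"
proof -
  let ?S = "Poly_Mapping.keys u \<union> Poly_Mapping.keys v"
  have "Poly_Mapping.keys (u + v) \<subseteq> ?S" by (rule Poly_Mapping.keys_add)
  then show ?thesis
    by (simp add: eval_monom_superset[of ?S] lookup_add power_add prod.distrib)
qed

lemma eval_mpoly_superset:
  assumes "finite S" "Poly_Mapping.keys f \<subseteq> S"
  shows "eval_mpoly \<alpha> f = (\<Sum>u\<in>S. Poly_Mapping.lookup f u * eval_monom \<alpha> u)"
  unfolding eval_mpoly_def eval_monom_def[symmetric] using assms
  by (intro sum.mono_neutral_left) (auto simp: in_keys_iff)

lemma eval_mpoly_add: "eval_mpoly \<alpha> (f + g) = eval_mpoly \<alpha> f + eval_mpoly \<alpha> g"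
proof -
  let ?S = "Poly_Mapping.keys f \<union> Poly_Mapping.keys g"
  have "Poly_Mapping.keys (f + g) \<subseteq> ?S" by (rule Poly_Mapping.keys_add)
  then show ?thesis
    by (simp add: eval_mpoly_superset[of ?S] lookup_add distrib_right sum.distrib)
qed

lemma eval_mpoly_0: "eval_mpoly \<alpha> 0 = 0"
  by (simp add: eval_mpoly_def)

lemma eval_mpoly_sum: "eval_mpoly \<alpha> (sum f I) = (\<Sum>i\<in>I. eval_mpoly \<alpha> (f i))"
  by (induction I rule: infinite_finite_induct) (simp_all add: eval_mpoly_add eval_mpoly_0)

lemma eval_mpoly_single: "eval_mpoly \<alpha> (Poly_Mapping.single u c) = c * eval_monom \<alpha> u"
  by (subst eval_mpoly_superset[of "{u}"]) auto

lemma eval_mpoly_Const: "eval_mpoly \<alpha> (Const c) = c"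
  by (simp add: Const_def eval_mpoly_single eval_monom_def)

lemma mpoly_expand:
  "f = (\<Sum>u\<in>Poly_Mapping.keys f. Poly_Mapping.single u (Poly_Mapping.lookup f u))" for f :: mpoly
  by (rule poly_mapping_eqI) (auto simp: lookup_sum lookup_single when_def in_keys_iff)

text \<open>Writing both factors as sums of single terms reduces the convolution product to
  \<open>mult_single\<close>, where multiplicativity is that of \<open>eval_monom\<close>.\<close>

lemma eval_mpoly_mult: "eval_mpoly \<alpha> (f * g) = eval_mpoly \<alpha> f * eval_mpoly \<alpha> g"
proof -
  have "f * g = (\<Sum>u\<in>Poly_Mapping.keys f. \<Sum>v\<in>Poly_Mapping.keys g.
      Poly_Mapping.single (u + v) (Poly_Mapping.lookup f u * Poly_Mapping.lookup g v))"
    by (subst mpoly_expand[of f], subst mpoly_expand[of g]) (simp add: sum_product mult_single)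
  then show ?thesis
    by (simp add: eval_mpoly_sum eval_mpoly_single eval_monom_add sum_product
        eval_mpoly_superset[of "Poly_Mapping.keys f" f] eval_mpoly_superset[of "Poly_Mapping.keys g" g]
        mult_ac)
qed

text \<open>With the embedding into the complex numbers built in, the general facts on entrywise
  ring homomorphisms apply to \<open>eval_cmat\<close>.\<close>

interpretation eval_hom: comm_ring_hom "\<lambda>f. complex_of_real (eval_mpoly \<alpha> f)" for \<alpha>
  using eval_mpoly_Const[of \<alpha> 1]
  by unfold_locales
    (simp_all add: eval_mpoly_add eval_mpoly_mult eval_mpoly_0 Const_def single_one)

lemma eval_mpoly_trunc:
  assumes "f \<in> polys p"
  shows "eval_mpoly (trunc p \<alpha>) f = eval_mpoly \<alpha> f"
  unfolding eval_mpoly_def using assms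
  by (intro sum.cong arg_cong2[where f = "(*)"] prod.cong) (auto simp: polys_def trunc_def)

section \<open>Evaluation of polynomial matrices\<close>

lemma poly_mats_carrier: "M \<in> poly_mats p k l \<Longrightarrow> M \<in> carrier_mat k l"
  by (simp add: poly_mats_def)

lemma eval_cmat_carrier [simp]: "eval_cmat \<alpha> M \<in> carrier_mat k l \<longleftrightarrow> M \<in> carrier_mat k l"
  by (auto simp: eval_cmat_def)

lemma dim_eval_cmat [simp]:
  "dim_row (eval_cmat \<alpha> M) = dim_row M" "dim_col (eval_cmat \<alpha> M) = dim_col M"
  by (simp_all add: eval_cmat_def)

text \<open>Polynomials in the first \<open>p\<close> variables read only the coordinates that
  \<open>trunc p\<close> keeps. Hence the reduced system at the truncated parameter and the
  certificate can be evaluated at the same point.\<close>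

lemma eval_cmat_trunc:
  assumes "M \<in> poly_mats p k l"
  shows "eval_cmat (trunc p \<alpha>) M = eval_cmat \<alpha> M"
proof -
  have "M $$ (i, j) \<in> polys p" if "i < k" "j < l" for i j
    using assms that elements_matI[of M k l i j] by (auto simp: poly_mats_def)
  then show ?thesis
    using assms unfolding eval_cmat_def poly_mats_def
    by (intro eq_matI) (auto simp: eval_mpoly_trunc)
qed

lemma eval_cmat_mult:
  "A \<in> carrier_mat k n \<Longrightarrow> B \<in> carrier_mat n l \<Longrightarrow> eval_cmat \<alpha> (A * B) = eval_cmat \<alpha> A * eval_cmat \<alpha> B"
  unfolding eval_cmat_def by (rule eval_hom.mat_hom_mult)

lemma eval_cmat_transpose: "eval_cmat \<alpha> (transpose_mat M) = transpose_mat (eval_cmat \<alpha> M)"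
  by (rule eq_matI) (auto simp: eval_cmat_def)

lemma eval_cmat_zero: "eval_cmat \<alpha> (0\<^sub>m k l) = 0\<^sub>m k l"
  by (rule eq_matI) (auto simp: eval_cmat_def)

lemma eval_cmat_one: "eval_cmat \<alpha> (1\<^sub>m k) = 1\<^sub>m k"
  unfolding eval_cmat_def by (rule eval_hom.mat_hom_one)

lemma eval_cmat_smult_Const: "eval_cmat \<alpha> (Const c \<cdot>\<^sub>m M) = complex_of_real c \<cdot>\<^sub>m eval_cmat \<alpha> M"
  by (rule eq_matI) (auto simp: eval_cmat_def eval_mpoly_mult eval_mpoly_Const)

lemma eval_cmat_four_block:
  assumes "A \<in> carrier_mat k l" "B \<in> carrier_mat k l'" "C \<in> carrier_mat k' l" "D \<in> carrier_mat k' l'"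
  shows "eval_cmat \<alpha> (four_block_mat A B C D) =
    four_block_mat (eval_cmat \<alpha> A) (eval_cmat \<alpha> B) (eval_cmat \<alpha> C) (eval_cmat \<alpha> D)"
  unfolding eval_cmat_def using map_four_block_mat[OF assms] .

lemma eval_cmat_append_rows:
  assumes "A \<in> carrier_mat k l" "B \<in> carrier_mat k' l"
  shows "eval_cmat \<alpha> (A @\<^sub>r B) = eval_cmat \<alpha> A @\<^sub>r eval_cmat \<alpha> B"
  unfolding append_rows_def using assms
  by (subst eval_cmat_four_block[of _ k l _ 0 _ k']) (auto simp: eval_cmat_zero carrier_matD[of _ _ l])

lemma eval_cmat_uminus: "eval_cmat \<alpha> (- M) = - eval_cmat \<alpha> M"
  by (rule eq_matI) (auto simp: eval_cmat_def eval_hom.hom_uminus)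

lemma eval_cmat_minus:
  "A \<in> carrier_mat k l \<Longrightarrow> B \<in> carrier_mat k l \<Longrightarrow> eval_cmat \<alpha> (A - B) = eval_cmat \<alpha> A - eval_cmat \<alpha> B"
  by (rule eq_matI) (auto simp: eval_cmat_def eval_hom.hom_minus)

section \<open>Real matrices, Hermitian forms and singular values\<close>

definition real_cmat :: "complex mat \<Rightarrow> bool" where
  "real_cmat M \<longleftrightarrow> map_mat cnj M = M"

lemma real_cmat_eval_cmat: "real_cmat (eval_cmat \<alpha> M)"
  unfolding real_cmat_def by (rule eq_matI) (auto simp: eval_cmat_def)

lemma conjugate_mult_mat_vec:
  fixes M :: "complex mat"
  assumes M: "M \<in> carrier_mat k l" and v: "v \<in> carrier_vec l"
  shows "conjugate (M *\<^sub>v v) = map_mat cnj M *\<^sub>v conjugate v"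
  using assms by (intro eq_vecI) (auto simp: scalar_prod_def)

text \<open>Conjugation passes through a real matrix, so its transpose acts as its adjoint even on
  complex vectors.\<close>

lemma cscalar_prod_transpose:
  assumes R: "real_cmat M" and M: "M \<in> carrier_mat k l"
    and x: "x \<in> carrier_vec l" and y: "y \<in> carrier_vec k"
  shows "(transpose_mat M *\<^sub>v y) \<bullet>c x = y \<bullet>c (M *\<^sub>v x)"
  using transpose_vec_mult_scalar[OF M _ y, of "conjugate x"] x conjugate_mult_mat_vec[OF M x] R
  by (simp add: real_cmat_def)

lemma mat_adjoint_eq: "mat_adjoint M = transpose_mat (map_mat cnj M)" for M :: "complex mat"
  by (rule eq_matI) (auto simp: mat_adjoint_def mat_of_rows_def)

lemma cscalar_prod_mat_adjoint:
  fixes M :: "complex mat"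
  assumes M: "M \<in> carrier_mat k l" and x: "x \<in> carrier_vec l" and y: "y \<in> carrier_vec k"
  shows "(mat_adjoint M *\<^sub>v y) \<bullet>c x = y \<bullet>c (M *\<^sub>v x)"
  unfolding mat_adjoint_eq conjugate_mult_mat_vec[OF M x]
  by (rule transpose_vec_mult_scalar[of _ k l]) (use assms in auto)

text \<open>In the order on the complex numbers, \<open>0 \<le> c\<close> includes that
  \<open>c\<close> is real, so positivity of the square yields both claims.\<close>

lemma cscalar_prod_self: "v \<bullet>c v = complex_of_real (Re (v \<bullet>c v))" "Re (v \<bullet>c v) \<ge> 0"
  for v :: "complex vec"
  using conjugate_square_ge_0_vec[of v] by (auto simp: less_eq_complex_def complex_eq_iff)

text \<open>An eigenvector u of M^* M for the eigenvalue e satisfies |M u|^2 = e |u|^2, so the gain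
  bound at u bounds e. This reduces a norm bound to an inequality for each input.\<close>

lemma largest_singular_value_le:
  assumes M: "M \<in> carrier_mat k l" and c: "c \<ge> 0"
    and bound: "\<And>u. u \<in> carrier_vec l \<Longrightarrow> Re ((M *\<^sub>v u) \<bullet>c (M *\<^sub>v u)) \<le> c\<^sup>2 * Re (u \<bullet>c u)"
  shows "largest_singular_value M \<le> c"
proof -
  have adj: "mat_adjoint M \<in> carrier_mat l k" using M by (auto simp: mat_adjoint_eq)
  then have MM: "mat_adjoint M * M \<in> carrier_mat l l" using M by auto
  have "sqrt (Re e) \<le> c" if e: "e \<in> spectrum (mat_adjoint M * M)" for e
  proof -
    from e obtain u where u: "u \<in> carrier_vec l" "u \<noteq> 0\<^sub>v l"
      and eu: "(mat_adjoint M * M) *\<^sub>v u = e \<cdot>\<^sub>v u"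
      using MM by (auto simp: spectrum_def eigenvalue_def eigenvector_def)
    have "(M *\<^sub>v u) \<bullet>c (M *\<^sub>v u) = (mat_adjoint M *\<^sub>v (M *\<^sub>v u)) \<bullet>c u"
      using cscalar_prod_mat_adjoint[OF M u(1), of "M *\<^sub>v u"] M u by auto
    also have "\<dots> = e * (u \<bullet>c u)"
      using eu adj M u by (simp add: assoc_mult_mat_vec[OF adj M u(1)] del: assoc_mult_mat_vec)
    \<comment> \<open>The factor \<open>u \<bullet>c u\<close> is real, so the real part of the
      product splits.\<close>
    finally have "Re ((M *\<^sub>v u) \<bullet>c (M *\<^sub>v u)) = Re e * Re (u \<bullet>c u)"
      using cscalar_prod_self(1)[of u] by (metis Re_complex_of_real times_complex.simps(1) Im_complex_of_real mult_zero_right diff_zero)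
    moreover have "Re (u \<bullet>c u) > 0"
      using conjugate_square_greater_0_vec[OF u(1)] u(2) by (auto simp: less_complex_def)
    ultimately have "Re e \<le> c\<^sup>2" using bound[OF u(1)] by simp
    then show ?thesis using c real_le_lsqrt by blast
  qed
  \<comment> \<open>The spectrum is finite, so \<open>Max\<close> is a genuine maximum;
    \<open>c \<ge> 0\<close> takes care of the inserted \<open>0\<close>.\<close>
  then show ?thesis
    unfolding largest_singular_value_def using c card_finite_spectrum(1)[OF MM] by auto
qed

section \<open>Transfer functions through states\<close>

text \<open>Injectivity is the form in which invertibility arises in both uses: for zI - A because z
  is not an eigenvalue, and for P because its form is definite.\<close>

lemma mat_inverse_obtain:
  fixes M :: "complex mat"
  assumes M: "M \<in> carrier_mat n n"
    and inj: "\<And>v. v \<in> carrier_vec n \<Longrightarrow> M *\<^sub>v v = 0\<^sub>v n \<Longrightarrow> v = 0\<^sub>v n"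
  obtains R where "mat_inverse M = Some R" "R \<in> carrier_mat n n" "M * R = 1\<^sub>m n"
proof -
  have "det M \<noteq> 0" using inj det_0_iff_vec_prod_zero[OF M] by blast
  then obtain R where R: "mat_inverse M = Some R"
    using mat_inverse(1)[OF M, where b = "()"] det_non_zero_imp_unit[OF M, where b = "()"] by blast
  then show thesis using that mat_inverse(2)[OF M] by blast
qed

lemma smult_mat_mult_vec:
  fixes M :: "complex mat"
  assumes "M \<in> carrier_mat k l" "v \<in> carrier_vec l"
  shows "(c \<cdot>\<^sub>m M) *\<^sub>v v = c \<cdot>\<^sub>v (M *\<^sub>v v)"
  using assms by (intro eq_vecI) (auto simp: scalar_prod_def sum_distrib_left mult.assoc)

text \<open>The state is the resolvent applied to \<open>B *\<^sub>v u\<close>. From here on only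
  the linear equation that it solves matters, and no inverse of zI - A enters the estimates.\<close>

lemma transfer_fun_state:
  assumes A: "A \<in> carrier_mat n n" and B: "B \<in> carrier_mat n m"
    and C: "C \<in> carrier_mat k n" and D: "D \<in> carrier_mat k m"
    and z: "z \<notin> spectrum A" and u: "u \<in> carrier_vec m"
  obtains x where "x \<in> carrier_vec n" "z \<cdot>\<^sub>v x = A *\<^sub>v x + B *\<^sub>v u"
    "transfer_fun A B C D z \<in> carrier_mat k m"
    "transfer_fun A B C D z *\<^sub>v u = C *\<^sub>v x + D *\<^sub>v u"
proof -
  let ?Z = "z \<cdot>\<^sub>m 1\<^sub>m n - A"
  have Z: "?Z \<in> carrier_mat n n" using A by auto
  have Zv: "?Z *\<^sub>v v = z \<cdot>\<^sub>v v - A *\<^sub>v v" if "v \<in> carrier_vec n" for v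
    using that A by (simp add: minus_mult_distrib_mat_vec[of _ n n] smult_mat_mult_vec[of _ n n])
  have "v = 0\<^sub>v n" if v: "v \<in> carrier_vec n" "?Z *\<^sub>v v = 0\<^sub>v n" for v
  proof (rule ccontr)
    assume "v \<noteq> 0\<^sub>v n"
    moreover have "A *\<^sub>v v = z \<cdot>\<^sub>v v"
    proof (rule eq_vecI)
      fix i assume "i < dim_vec (z \<cdot>\<^sub>v v)"
      then show "(A *\<^sub>v v) $ i = (z \<cdot>\<^sub>v v) $ i"
        using v A arg_cong[OF Zv[OF v(1)], of "\<lambda>w. w $ i"] by auto
    qed (use v A in auto)
    ultimately show False
      using z v A by (auto simp: spectrum_def eigenvalue_def eigenvector_def)
  qed
  then obtain R where R: "mat_inverse ?Z = Some R" and Rc: "R \<in> carrier_mat n n"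
    and ZR: "?Z * R = 1\<^sub>m n"
    using mat_inverse_obtain[OF Z] by blast
  let ?x = "R *\<^sub>v (B *\<^sub>v u)"
  have Bu: "B *\<^sub>v u \<in> carrier_vec n" using B u by auto
  have x: "?x \<in> carrier_vec n" using Rc Bu by auto
  have "z \<cdot>\<^sub>v ?x - A *\<^sub>v ?x = B *\<^sub>v u"
    using Zv[OF x] assoc_mult_mat_vec[OF Z Rc Bu] Bu by (simp add: ZR)
  then have eq: "z \<cdot>\<^sub>v ?x = A *\<^sub>v ?x + B *\<^sub>v u"
    using x A Bu Rc by (auto simp: vec_eq_iff algebra_simps)
  have T: "transfer_fun A B C D z = C * R * B + D"
    using A R by (simp add: transfer_fun_def)
  show thesis
  proof (rule that[OF x eq])
    show "transfer_fun A B C D z \<in> carrier_mat k m" using T D by auto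
    show "transfer_fun A B C D z *\<^sub>v u = C *\<^sub>v ?x + D *\<^sub>v u"
      unfolding T using B C D Rc u Bu
      by (simp add: add_mult_distrib_mat_vec[of _ k m] assoc_mult_mat_vec[of _ k n _ m] assoc_mult_mat_vec[of _ k n _ n])
  qed
qed

section \<open>The Hermitian form of the block matrix\<close>

lemma cscalar_prod_append:
  fixes a d :: "complex vec"
  assumes "a \<in> carrier_vec k" "a' \<in> carrier_vec k" "d \<in> carrier_vec l" "d' \<in> carrier_vec l"
  shows "(a @\<^sub>v d) \<bullet>c (a' @\<^sub>v d') = a \<bullet>c a' + d \<bullet>c d'"
proof -
  have "conjugate (a' @\<^sub>v d') = conjugate a' @\<^sub>v conjugate d'"
    using assms by (intro eq_vecI) auto
  then show ?thesis
    using assms by (simp add: scalar_prod_append[of _ k _ l])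
qed

text \<open>The left and right vectors differ because the off-diagonal outer blocks pair different
  halves of the test vector.\<close>

lemma cscalar_prod_four_block:
  fixes A :: "complex mat"
  assumes "A \<in> carrier_mat k l" "B \<in> carrier_mat k l'" "C \<in> carrier_mat k' l" "D \<in> carrier_mat k' l'"
    and "a \<in> carrier_vec l" "d \<in> carrier_vec l'" "a' \<in> carrier_vec k" "d' \<in> carrier_vec k'"
  shows "(four_block_mat A B C D *\<^sub>v (a @\<^sub>v d)) \<bullet>c (a' @\<^sub>v d') =
    (A *\<^sub>v a) \<bullet>c a' + (B *\<^sub>v d) \<bullet>c a' + (C *\<^sub>v a) \<bullet>c d' + (D *\<^sub>v d) \<bullet>c d'"
  using assms
  by (simp add: four_block_mat_mult_vec[of _ k l _ l' _ k'] cscalar_prod_append[of _ k _ _ k']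
      add_scalar_prod_distrib[of _ k] add_scalar_prod_distrib[of _ k'])

lemma zero_mat_mult_vec [simp]: "v \<in> carrier_vec l \<Longrightarrow> 0\<^sub>m k l *\<^sub>v v = 0\<^sub>v k"
  by (intro eq_vecI) auto

lemma mat_mult_zero_vec: "M \<in> carrier_mat k l \<Longrightarrow> M *\<^sub>v 0\<^sub>v l = 0\<^sub>v k"
  for M :: "complex mat"
  by (intro eq_vecI) auto

text \<open>The block matrix of the bounded real lemma, with \<open>g\<close> in the role of \<open>\<gamma>\<^sup>2\<close>.\<close>

definition brl_mat ::
  "'a::comm_ring_1 mat \<Rightarrow> 'a mat \<Rightarrow> 'a mat \<Rightarrow> 'a mat \<Rightarrow> 'a mat \<Rightarrow> 'a \<Rightarrow> nat \<Rightarrow> nat \<Rightarrow> nat \<Rightarrow> 'a mat" where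
  "brl_mat P A B C D g n m k = four_block_mat
     (four_block_mat P (A * P) (P * transpose_mat A) P)
     (four_block_mat B (0\<^sub>m n k) (0\<^sub>m n m) (P * transpose_mat C))
     (four_block_mat (transpose_mat B) (0\<^sub>m m n) (0\<^sub>m k n) (C * P))
     (four_block_mat (1\<^sub>m m) (transpose_mat D) D (g \<cdot>\<^sub>m 1\<^sub>m k))"

text \<open>Splitting the outer and then the inner blocks leaves one summand for each of the twelve
  nonzero blocks.\<close>

lemma cscalar_prod_brl_mat:
  fixes A B C D P :: "complex mat"
  assumes A: "A \<in> carrier_mat n n" and B: "B \<in> carrier_mat n m"
    and C: "C \<in> carrier_mat k n" and D: "D \<in> carrier_mat k m" and P: "P \<in> carrier_mat n n"
    and a: "a \<in> carrier_vec n" and b: "b \<in> carrier_vec n"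
    and c: "c \<in> carrier_vec m" and d: "d \<in> carrier_vec k"
  shows "(brl_mat P A B C D g n m k *\<^sub>v ((a @\<^sub>v b) @\<^sub>v (c @\<^sub>v d))) \<bullet>c ((a @\<^sub>v b) @\<^sub>v (c @\<^sub>v d)) =
    (P *\<^sub>v a) \<bullet>c a + (A *\<^sub>v (P *\<^sub>v b)) \<bullet>c a + (P *\<^sub>v (transpose_mat A *\<^sub>v a)) \<bullet>c b + (P *\<^sub>v b) \<bullet>c b
    + (B *\<^sub>v c) \<bullet>c a + (P *\<^sub>v (transpose_mat C *\<^sub>v d)) \<bullet>c b
    + (transpose_mat B *\<^sub>v a) \<bullet>c c + (C *\<^sub>v (P *\<^sub>v b)) \<bullet>c d
    + c \<bullet>c c + (transpose_mat D *\<^sub>v d) \<bullet>c c + (D *\<^sub>v c) \<bullet>c d + g * (d \<bullet>c d)"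
proof -
  note carr = assms transpose_carrier_mat[THEN iffD2, OF A] transpose_carrier_mat[THEN iffD2, OF B]
    transpose_carrier_mat[THEN iffD2, OF C] transpose_carrier_mat[THEN iffD2, OF D]
  note sub = cscalar_prod_four_block[of _ n n _ n _ n] cscalar_prod_four_block[of _ n m _ k _ n]
    cscalar_prod_four_block[of _ m n _ n _ k] cscalar_prod_four_block[of _ m m _ k _ k]
  show ?thesis
    unfolding brl_mat_def
    by (subst cscalar_prod_four_block[of _ "n + n" "n + n" _ "m + k" _ "m + k"])
      (use carr in \<open>simp_all add: sub assoc_mult_mat_vec[of _ n n _ n] assoc_mult_mat_vec[of _ n n _ k]
        assoc_mult_mat_vec[of _ k n _ n] smult_mat_mult_vec[of _ k k]\<close>)
qed

lemma cscalar_prod_smult_left: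
  fixes v w :: "complex vec"
  assumes "v \<in> carrier_vec n" "w \<in> carrier_vec n"
  shows "(c \<cdot>\<^sub>v v) \<bullet>c w = c * (v \<bullet>c w)"
  using assms by simp

lemma cscalar_prod_smult_right:
  fixes v w :: "complex vec"
  assumes "v \<in> carrier_vec n" "w \<in> carrier_vec n"
  shows "v \<bullet>c (c \<cdot>\<^sub>v w) = cnj c * (v \<bullet>c w)"
  using assms by (simp add: conjugate_smult_vec)

lemma cscalar_prod_add_right:
  fixes v w w' :: "complex vec"
  assumes "v \<in> carrier_vec n" "w \<in> carrier_vec n" "w' \<in> carrier_vec n"
  shows "v \<bullet>c (w + w') = v \<bullet>c w + v \<bullet>c w'"
  using assms by (simp add: conjugate_add_vec[of _ n] scalar_prod_add_distrib[of _ n])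

text \<open>
  Here \<open>v = P\<^sup>-\<^sup>1 x\<close> for a state \<open>x\<close> with \<open>z x = A x + B u\<close>, so the first summand is
  \<open>1 - |z|\<^sup>2\<close> times the storage function \<open>x\<^sup>* P\<^sup>-\<^sup>1 x\<close>.
\<close>

lemma brl_mat_dissipation:
  fixes A B C D P :: "complex mat" and g t :: real
  assumes A: "A \<in> carrier_mat n n" and B: "B \<in> carrier_mat n m"
    and C: "C \<in> carrier_mat k n" and D: "D \<in> carrier_mat k m" and P: "P \<in> carrier_mat n n"
    and real: "real_cmat A" "real_cmat B" "real_cmat C" "real_cmat D" "real_cmat P"
    and sym: "transpose_mat P = P"
    and v: "v \<in> carrier_vec n" and u: "u \<in> carrier_vec m"
    and state: "z \<cdot>\<^sub>v (P *\<^sub>v v) = A *\<^sub>v (P *\<^sub>v v) + B *\<^sub>v u"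
  defines "y \<equiv> C *\<^sub>v (P *\<^sub>v v) + D *\<^sub>v u"
  defines "s \<equiv> ((- z \<cdot>\<^sub>v v) @\<^sub>v v) @\<^sub>v (u @\<^sub>v (complex_of_real (- t) \<cdot>\<^sub>v y))"
  shows "(brl_mat P A B C D g n m k *\<^sub>v s) \<bullet>c s =
    (1 - z * cnj z) * ((P *\<^sub>v v) \<bullet>c v) + u \<bullet>c u - 2 * t * (y \<bullet>c y) + g * t\<^sup>2 * (y \<bullet>c y)"
proof -
  define x where "x = P *\<^sub>v v"
  define a where "a = - z \<cdot>\<^sub>v v"
  define d where "d = complex_of_real (- t) \<cdot>\<^sub>v y"
  have x: "x \<in> carrier_vec n" and a: "a \<in> carrier_vec n" using P v by (auto simp: x_def a_def)
  have Ax: "A *\<^sub>v x \<in> carrier_vec n" and Bu: "B *\<^sub>v u \<in> carrier_vec n"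
    and Cx: "C *\<^sub>v x \<in> carrier_vec k" and Du: "D *\<^sub>v u \<in> carrier_vec k"
    using A B C D x u by auto
  have y_eq: "y = C *\<^sub>v x + D *\<^sub>v u" by (simp add: y_def x_def)
  have y: "y \<in> carrier_vec k" using Cx Du by (simp add: y_eq)
  have d: "d \<in> carrier_vec k" using y by (simp add: d_def)
  \<comment> \<open>\<open>P\<close> is real and symmetric, hence self-adjoint; moved to the right
    it turns \<open>v\<close> into the state \<open>x\<close>.\<close>
  have Pt: "(P *\<^sub>v w) \<bullet>c v = w \<bullet>c x" if "w \<in> carrier_vec n" for w
    using cscalar_prod_transpose[OF real(5) P v that] by (simp add: sym x_def)
  have vx: "v \<bullet>c x = x \<bullet>c v" using Pt[OF v] by (simp add: x_def)
  have Pa: "P *\<^sub>v a = - z \<cdot>\<^sub>v x" using mult_mat_vec[OF P v, of "- z"] by (simp add: a_def x_def)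
  \<comment> \<open>The state equation merges each pair of \<open>A\<close> and \<open>B\<close>
    blocks, in 1 directly and in 2 after taking adjoints. The output equation does the same for
    \<open>C\<close> and \<open>D\<close> in 4 and 3.\<close>
  have 1: "(A *\<^sub>v x) \<bullet>c a + (B *\<^sub>v u) \<bullet>c a = (z \<cdot>\<^sub>v x) \<bullet>c a"
    using state Ax Bu a by (simp add: x_def[symmetric] add_scalar_prod_distrib[of _ n])
  have 2: "(P *\<^sub>v (transpose_mat A *\<^sub>v a)) \<bullet>c v + (transpose_mat B *\<^sub>v a) \<bullet>c u = a \<bullet>c (z \<cdot>\<^sub>v x)"
    using A B state a u x Ax Bu
    by (simp add: Pt cscalar_prod_transpose[OF real(1) A] cscalar_prod_transpose[OF real(2) B]
        x_def[symmetric] cscalar_prod_add_right[of _ n])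
  have 3: "(P *\<^sub>v (transpose_mat C *\<^sub>v d)) \<bullet>c v + (transpose_mat D *\<^sub>v d) \<bullet>c u = d \<bullet>c y"
    using C D d u x Cx Du
    by (simp add: Pt cscalar_prod_transpose[OF real(3) C] cscalar_prod_transpose[OF real(4) D]
        y_eq cscalar_prod_add_right[of _ k])
  have 4: "(C *\<^sub>v x) \<bullet>c d + (D *\<^sub>v u) \<bullet>c d = y \<bullet>c d"
    using Cx Du d by (simp add: y_eq add_scalar_prod_distrib[of _ k])
  have "(brl_mat P A B C D g n m k *\<^sub>v s) \<bullet>c s =
      (P *\<^sub>v a) \<bullet>c a + (z \<cdot>\<^sub>v x) \<bullet>c a + a \<bullet>c (z \<cdot>\<^sub>v x) + x \<bullet>c v + d \<bullet>c y + y \<bullet>c d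
      + u \<bullet>c u + g * (d \<bullet>c d)"
    unfolding s_def a_def[symmetric] d_def[symmetric]
      cscalar_prod_brl_mat[OF A B C D P a v u d] x_def[symmetric] 1[symmetric] 2[symmetric]
      3[symmetric] 4[symmetric]
    by simp
  \<comment> \<open>With \<open>a = - z \<cdot>\<^sub>v v\<close>, the square in \<open>a\<close>
    contributes |z|^2 times \<open>x \<bullet>c v\<close> and each of the two cross terms minus that
    amount. Together with the second diagonal block the factor becomes 1 - |z|^2.\<close>
  also have "\<dots> = z * cnj z * (x \<bullet>c v) - 2 * z * cnj z * (x \<bullet>c v) + x \<bullet>c v
      - 2 * t * (y \<bullet>c y) + u \<bullet>c u + g * t\<^sup>2 * (y \<bullet>c y)"
    unfolding Pa unfolding a_def d_def using x v y
    by (simp add: cscalar_prod_smult_left[of _ n] cscalar_prod_smult_right[of _ n]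
        cscalar_prod_smult_left[of _ k] cscalar_prod_smult_right[of _ k] vx power2_eq_square algebra_simps
        del: smult_scalar_prod_distrib scalar_prod_smult_distrib)
  finally show ?thesis by (simp add: x_def algebra_simps)
qed

lemma bounded_real:
  fixes A B C D P :: "complex mat" and \<epsilon> \<gamma> :: real
  assumes A: "A \<in> carrier_mat n n" and B: "B \<in> carrier_mat n m"
    and C: "C \<in> carrier_mat k n" and D: "D \<in> carrier_mat k m" and P: "P \<in> carrier_mat n n"
    and real: "real_cmat A" "real_cmat B" "real_cmat C" "real_cmat D" "real_cmat P"
    and sym: "transpose_mat P = P"
    and \<epsilon>: "\<epsilon> > 0"
    and lmi: "\<And>s. s \<in> carrier_vec ((n + n) + (m + k)) \<Longrightarrow>
      \<epsilon> * Re (s \<bullet>c s) \<le> Re ((brl_mat P A B C D (complex_of_real (\<gamma>\<^sup>2)) n m k *\<^sub>v s) \<bullet>c s)"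
    and z: "cmod z > 1" and x: "x \<in> carrier_vec n" and u: "u \<in> carrier_vec m"
    and state: "z \<cdot>\<^sub>v x = A *\<^sub>v x + B *\<^sub>v u"
  defines "y \<equiv> C *\<^sub>v x + D *\<^sub>v u"
  shows "Re (y \<bullet>c y) \<le> \<gamma>\<^sup>2 * Re (u \<bullet>c u)"
proof -
  \<comment> \<open>A test vector supported in the first entry isolates the block \<open>P\<close>.
    The margin \<open>\<epsilon>\<close> makes its form definite, so \<open>P\<close> is injective
    and every state can be written as \<open>P *\<^sub>v v\<close>.\<close>
  have pos: "\<epsilon> * Re (v \<bullet>c v) \<le> Re ((P *\<^sub>v v) \<bullet>c v)" if v: "v \<in> carrier_vec n" for v
  proof -
    let ?s = "(v @\<^sub>v 0\<^sub>v n) @\<^sub>v (0\<^sub>v m @\<^sub>v 0\<^sub>v k)"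
    have s: "?s \<in> carrier_vec ((n + n) + (m + k))" using v by simp
    have "?s \<bullet>c ?s = v \<bullet>c v"
      using v by (subst cscalar_prod_append[of _ "n + n" _ _ "m + k"], simp_all,
        subst cscalar_prod_append[of _ n _ _ n], simp_all, subst cscalar_prod_append[of _ m _ _ k], simp_all)
    moreover have "(brl_mat P A B C D (complex_of_real (\<gamma>\<^sup>2)) n m k *\<^sub>v ?s) \<bullet>c ?s = (P *\<^sub>v v) \<bullet>c v"
    proof -
      have "P *\<^sub>v v \<in> carrier_vec n" "transpose_mat A *\<^sub>v v \<in> carrier_vec n" "transpose_mat B *\<^sub>v v \<in> carrier_vec m"
        "P *\<^sub>v (transpose_mat A *\<^sub>v v) \<in> carrier_vec n"
        using A B P v by (auto intro!: mult_mat_vec_carrier)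
      then show ?thesis
        unfolding cscalar_prod_brl_mat[OF A B C D P v zero_carrier_vec zero_carrier_vec zero_carrier_vec]
        using v A B C D P
        by (simp add: mat_mult_zero_vec[OF P] mat_mult_zero_vec[OF A] mat_mult_zero_vec[OF B] mat_mult_zero_vec[OF C]
            mat_mult_zero_vec[OF D] mat_mult_zero_vec[OF transpose_carrier_mat[THEN iffD2, OF C]]
            mat_mult_zero_vec[OF transpose_carrier_mat[THEN iffD2, OF D]])
    qed
    ultimately show ?thesis using lmi[OF s] by simp
  qed
  have "v = 0\<^sub>v n" if v: "v \<in> carrier_vec n" "P *\<^sub>v v = 0\<^sub>v n" for v
  proof (rule ccontr)
    assume "v \<noteq> 0\<^sub>v n"
    then have "0 < \<epsilon> * Re (v \<bullet>c v)"
      using conjugate_square_greater_0_vec[OF v(1)] \<epsilon> by (simp add: less_complex_def)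
    then show False using pos[OF v(1)] v by simp
  qed
  then obtain R where R: "R \<in> carrier_mat n n" "P * R = 1\<^sub>m n"
    using mat_inverse_obtain[OF P] by blast
  define v where "v = R *\<^sub>v x"
  have v: "v \<in> carrier_vec n" using R x by (simp add: v_def)
  have Pv: "P *\<^sub>v v = x" using assoc_mult_mat_vec[OF P R(1) x] R x by (simp add: v_def)
  define X Y U where "X = Re (x \<bullet>c v)" and "Y = Re (y \<bullet>c y)" and "U = Re (u \<bullet>c u)"
  have XYU: "X \<ge> 0" "Y \<ge> 0" "U \<ge> 0"
    using order_trans[OF mult_nonneg_nonneg pos[OF v]] \<epsilon> cscalar_prod_self(2)
    by (simp_all add: X_def Y_def U_def Pv)
  have y: "y \<in> carrier_vec k" using C D x u by (simp add: y_def)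
  have key: "2 * t * Y \<le> U + \<gamma>\<^sup>2 * t\<^sup>2 * Y" for t :: real
  proof -
    let ?s = "((- z \<cdot>\<^sub>v v) @\<^sub>v v) @\<^sub>v (u @\<^sub>v (complex_of_real (- t) \<cdot>\<^sub>v y))"
    have "?s \<in> carrier_vec ((n + n) + (m + k))" using v u y by simp
    then have "0 \<le> Re ((brl_mat P A B C D (complex_of_real (\<gamma>\<^sup>2)) n m k *\<^sub>v ?s) \<bullet>c ?s)"
      using lmi[of ?s] \<epsilon> cscalar_prod_self(2)[of ?s] by (meson mult_nonneg_nonneg less_imp_le order_trans)
    also have "\<dots> = Re ((1 - z * cnj z) * (x \<bullet>c v) + u \<bullet>c u - 2 * t * (y \<bullet>c y)
        + complex_of_real (\<gamma>\<^sup>2) * t\<^sup>2 * (y \<bullet>c y))"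
      using brl_mat_dissipation[OF A B C D P real sym v u, of z "\<gamma>\<^sup>2" t] state
      by (simp add: Pv y_def)
    also have "1 - z * cnj z = complex_of_real (1 - (cmod z)\<^sup>2)"
      using complex_norm_square[of z] by simp
    also have "Re (complex_of_real (1 - (cmod z)\<^sup>2) * (x \<bullet>c v) + u \<bullet>c u - 2 * t * (y \<bullet>c y)
        + complex_of_real (\<gamma>\<^sup>2) * t\<^sup>2 * (y \<bullet>c y)) = (1 - (cmod z)\<^sup>2) * X + U - 2 * t * Y + \<gamma>\<^sup>2 * t\<^sup>2 * Y"
      unfolding X_def Y_def U_def by (simp flip: of_real_power of_real_mult of_real_diff)
    finally have "0 \<le> (1 - (cmod z)\<^sup>2) * X + U - 2 * t * Y + \<gamma>\<^sup>2 * t\<^sup>2 * Y" .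
    moreover have "(1 - (cmod z)\<^sup>2) * X \<le> 0"
      using z XYU(1) by (intro mult_nonpos_nonneg) (auto simp: one_le_power)
    ultimately show ?thesis by linarith
  qed
  show ?thesis
  proof (cases "\<gamma> = 0")
    case True
    \<comment> \<open>For \<open>\<gamma> = 0\<close> the inequality reads 2 t Y \<le> U for every
      t; the value of t used below would make the left side U + 1.\<close>
    have "Y = 0"
    proof (rule ccontr)
      assume "Y \<noteq> 0"
      then show False using key[of "(U + 1) / (2 * Y)"] True by simp
    qed
    then show ?thesis using True by (simp add: Y_def)
  next
    case False
    \<comment> \<open>t = 1/\<gamma>^2 minimises \<gamma>^2 t^2 - 2 t, with least value
      -1/\<gamma>^2.\<close>
    then have "\<gamma>\<^sup>2 * (1 / \<gamma>\<^sup>2)\<^sup>2 * Y = Y / \<gamma>\<^sup>2"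
      by (simp add: power2_eq_square)
    then have "Y / \<gamma>\<^sup>2 \<le> U"
      using key[of "1 / \<gamma>\<^sup>2"] by simp
    then show ?thesis
      using False by (simp add: field_simps Y_def U_def)
  qed
qed

section \<open>Sum-of-squares certificates\<close>

lemma sos_mats_carrier: "Q \<in> sos_mats p N \<Longrightarrow> Q \<in> carrier_mat N N"
  by (auto simp: sos_mats_def poly_mats_carrier)

lemma sos_mats_transpose: "Q \<in> sos_mats p N \<Longrightarrow> transpose_mat Q = Q"
  by (auto simp: sos_mats_def poly_mats_def transpose_mult[of _ N N _ N])

text \<open>The form equals |Y s|^2, for complex \<open>s\<close> too, because the evaluated factor
  is real.\<close>

lemma sos_mats_nonneg:
  assumes Q: "Q \<in> sos_mats p N" and s: "s \<in> carrier_vec N"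
  shows "Re ((eval_cmat \<alpha> Q *\<^sub>v s) \<bullet>c s) \<ge> 0"
proof -
  obtain Y where Y: "Y \<in> carrier_mat N N" and QY: "Q = transpose_mat Y * Y"
    using Q by (auto simp: sos_mats_def poly_mats_def)
  let ?Y = "eval_cmat \<alpha> Y"
  have Ys: "?Y *\<^sub>v s \<in> carrier_vec N" and Yc: "?Y \<in> carrier_mat N N"
    and Yt: "transpose_mat ?Y \<in> carrier_mat N N" using Y s by auto
  have "eval_cmat \<alpha> Q *\<^sub>v s = transpose_mat ?Y *\<^sub>v (?Y *\<^sub>v s)"
    unfolding QY using Y
    by (simp add: eval_cmat_mult[of _ N N] eval_cmat_transpose assoc_mult_mat_vec[OF Yt Yc s])
  then show ?thesis
    using cscalar_prod_transpose[OF real_cmat_eval_cmat Yc s Ys] cscalar_prod_self(2) by simp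
qed

lemma eval_cmat_mat_sum:
  assumes "\<And>l. l \<in> I \<Longrightarrow> F l \<in> carrier_mat k k'"
  shows "eval_cmat \<alpha> (mat_sum k k' F I) = mat_sum k k' (\<lambda>l. eval_cmat \<alpha> (F l)) I"
proof (rule eq_matI)
  fix i j assume ij: "i < dim_row (mat_sum k k' (\<lambda>l. eval_cmat \<alpha> (F l)) I)"
    "j < dim_col (mat_sum k k' (\<lambda>l. eval_cmat \<alpha> (F l)) I)"
  have "complex_of_real (eval_mpoly \<alpha> (F l $$ (i, j))) = eval_cmat \<alpha> (F l) $$ (i, j)" if "l \<in> I" for l
    using assms[OF that] ij by (auto simp: mat_sum_def eval_cmat_def)
  moreover have "eval_cmat \<alpha> (mat_sum k k' F I) $$ (i, j) =
      (\<Sum>l\<in>I. complex_of_real (eval_mpoly \<alpha> (F l $$ (i, j))))"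
    using ij by (simp add: mat_sum_def eval_cmat_def eval_mpoly_sum)
  ultimately show "eval_cmat \<alpha> (mat_sum k k' F I) $$ (i, j) =
      mat_sum k k' (\<lambda>l. eval_cmat \<alpha> (F l)) I $$ (i, j)"
    using ij by (simp add: mat_sum_def)
qed (simp_all add: mat_sum_def)

lemma cscalar_prod_mat_sum:
  fixes F :: "'i \<Rightarrow> complex mat"
  assumes F: "\<And>l. l \<in> I \<Longrightarrow> F l \<in> carrier_mat k k'" and v: "v \<in> carrier_vec k'" and w: "w \<in> carrier_vec k"
  shows "(mat_sum k k' F I *\<^sub>v v) \<bullet>c w = (\<Sum>l\<in>I. (F l *\<^sub>v v) \<bullet>c w)"
proof -
  have "(mat_sum k k' F I *\<^sub>v v) \<bullet>c w =
      (\<Sum>i = 0..<k. \<Sum>j = 0..<k'. \<Sum>l\<in>I. F l $$ (i, j) * v $ j * cnj (w $ i))"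
    using v w by (simp add: mat_sum_def scalar_prod_def sum_distrib_right)
  also have "\<dots> = (\<Sum>i = 0..<k. \<Sum>l\<in>I. \<Sum>j = 0..<k'. F l $$ (i, j) * v $ j * cnj (w $ i))"
    by (intro sum.cong refl sum.swap)
  also have "\<dots> = (\<Sum>l\<in>I. \<Sum>i = 0..<k. \<Sum>j = 0..<k'. F l $$ (i, j) * v $ j * cnj (w $ i))"
    by (rule sum.swap)
  also have "\<dots> = (\<Sum>l\<in>I. (F l *\<^sub>v v) \<bullet>c w)"
  proof (rule sum.cong[OF refl])
    fix l assume "l \<in> I"
    from F[OF this] show "(\<Sum>i = 0..<k. \<Sum>j = 0..<k'. F l $$ (i, j) * v $ j * cnj (w $ i)) = (F l *\<^sub>v v) \<bullet>c w"
      using v w by (auto simp: scalar_prod_def sum_distrib_right intro!: sum.cong)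
  qed
  finally show ?thesis .
qed

text \<open>At the given point the \<open>q l\<close> are nonnegative weights on positive
  semidefinite matrices, so the evaluated identity leaves \<open>X\<close> minus
  \<open>\<epsilon>\<close> times the identity positive semidefinite.\<close>

lemma sos_certificate_lower_bound:
  fixes q :: "nat \<Rightarrow> mpoly"
  assumes X: "X \<in> carrier_mat N N"
    and cert: "X - Const \<epsilon> \<cdot>\<^sub>m 1\<^sub>m N - Q 0 - mat_sum N N (\<lambda>l. q l \<cdot>\<^sub>m Q l) {1..L} = 0\<^sub>m N N"
    and Q: "\<And>l. l \<in> {0..L} \<Longrightarrow> Q l \<in> sos_mats p N"
    and q: "\<And>l. l \<in> {1..L} \<Longrightarrow> eval_mpoly \<alpha> (q l) \<ge> 0"
    and s: "s \<in> carrier_vec N"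
  shows "\<epsilon> * Re (s \<bullet>c s) \<le> Re ((eval_cmat \<alpha> X *\<^sub>v s) \<bullet>c s)"
proof -
  let ?S = "mat_sum N N (\<lambda>l. q l \<cdot>\<^sub>m Q l) {1..L}"
  let ?E = "\<lambda>M. eval_cmat \<alpha> M"
  have Qc: "Q l \<in> carrier_mat N N" if "l \<in> {0..L}" for l
    using Q[OF that] by (rule sos_mats_carrier)
  have Q0: "Q 0 \<in> carrier_mat N N" using Qc[of 0] by simp
  have S: "?S \<in> carrier_mat N N" by (simp add: mat_sum_def)
  have I: "Const \<epsilon> \<cdot>\<^sub>m 1\<^sub>m N \<in> carrier_mat N N" by simp
  have XI: "X - Const \<epsilon> \<cdot>\<^sub>m 1\<^sub>m N \<in> carrier_mat N N"
    and XIQ: "X - Const \<epsilon> \<cdot>\<^sub>m 1\<^sub>m N - Q 0 \<in> carrier_mat N N"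
    by (rule minus_carrier_mat[OF I], rule minus_carrier_mat[OF Q0])
  note E = eval_cmat_carrier[THEN iffD2]
  have "?E X - ?E (Const \<epsilon> \<cdot>\<^sub>m 1\<^sub>m N) - ?E (Q 0) - ?E ?S = 0\<^sub>m N N"
    using arg_cong[OF cert, of ?E]
    unfolding eval_cmat_minus[OF XIQ S] eval_cmat_minus[OF XI Q0] eval_cmat_minus[OF X I] eval_cmat_zero .
  then have "(?E X - ?E (Const \<epsilon> \<cdot>\<^sub>m 1\<^sub>m N) - ?E (Q 0) - ?E ?S) *\<^sub>v s = 0\<^sub>v N"
    using s by simp
  then have "?E X *\<^sub>v s - ?E (Const \<epsilon> \<cdot>\<^sub>m 1\<^sub>m N) *\<^sub>v s - ?E (Q 0) *\<^sub>v s - ?E ?S *\<^sub>v s = 0\<^sub>v N"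
    unfolding minus_mult_distrib_mat_vec[OF minus_carrier_mat[OF E[OF Q0]] E[OF S] s]
      minus_mult_distrib_mat_vec[OF minus_carrier_mat[OF E[OF I]] E[OF Q0] s]
      minus_mult_distrib_mat_vec[OF E[OF X] E[OF I] s] .
  then have "0 = (?E X *\<^sub>v s - ?E (Const \<epsilon> \<cdot>\<^sub>m 1\<^sub>m N) *\<^sub>v s - ?E (Q 0) *\<^sub>v s - ?E ?S *\<^sub>v s) \<bullet>c s"
    using s by simp
  also have "\<dots> = (?E X *\<^sub>v s) \<bullet>c s - (?E (Const \<epsilon> \<cdot>\<^sub>m 1\<^sub>m N) *\<^sub>v s) \<bullet>c s
      - (?E (Q 0) *\<^sub>v s) \<bullet>c s - (?E ?S *\<^sub>v s) \<bullet>c s"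
  proof -
    have "?E M *\<^sub>v s \<in> carrier_vec N" if "M \<in> carrier_mat N N" for M
      using that s by (auto intro!: mult_mat_vec_carrier)
    from this[OF X] this[OF I] this[OF Q0] this[OF S] s show ?thesis
      by (simp add: minus_scalar_prod_distrib[of _ N] del: mult_mat_vec_carrier)
  qed
  also have "(?E (Const \<epsilon> \<cdot>\<^sub>m 1\<^sub>m N) *\<^sub>v s) \<bullet>c s = \<epsilon> * (s \<bullet>c s)"
    using s by (simp add: eval_cmat_smult_Const eval_cmat_one smult_mat_mult_vec[of _ N N])
  also have "(?E ?S *\<^sub>v s) \<bullet>c s = (\<Sum>l\<in>{1..L}. eval_mpoly \<alpha> (q l) * ((?E (Q l) *\<^sub>v s) \<bullet>c s))"
  proof -
    have "?E (q l \<cdot>\<^sub>m Q l) *\<^sub>v s = complex_of_real (eval_mpoly \<alpha> (q l)) \<cdot>\<^sub>v (?E (Q l) *\<^sub>v s)"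
      if "l \<in> {1..L}" for l
    proof -
      have "?E (q l \<cdot>\<^sub>m Q l) = complex_of_real (eval_mpoly \<alpha> (q l)) \<cdot>\<^sub>m ?E (Q l)"
        by (rule eq_matI) (auto simp: eval_cmat_def eval_mpoly_mult)
      then show ?thesis using Qc[of l] that s by (simp add: smult_mat_mult_vec[of _ N N])
    qed
    moreover have "?E (Q l) *\<^sub>v s \<in> carrier_vec N" if "l \<in> {1..L}" for l
      using Qc[of l] that s by (auto intro!: mult_mat_vec_carrier)
    moreover have "(?E ?S *\<^sub>v s) \<bullet>c s = (\<Sum>l\<in>{1..L}. (?E (q l \<cdot>\<^sub>m Q l) *\<^sub>v s) \<bullet>c s)"
      using Qc s by (subst eval_cmat_mat_sum) (auto intro!: cscalar_prod_mat_sum)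
    ultimately show ?thesis
      using s by (simp add: cscalar_prod_smult_left[of _ N] del: smult_scalar_prod_distrib)
  qed
  finally have "Re ((?E X *\<^sub>v s) \<bullet>c s) = \<epsilon> * Re (s \<bullet>c s) + Re ((?E (Q 0) *\<^sub>v s) \<bullet>c s)
      + (\<Sum>l\<in>{1..L}. eval_mpoly \<alpha> (q l) * Re ((?E (Q l) *\<^sub>v s) \<bullet>c s))"
    by (simp add: complex_eq_iff algebra_simps)
  moreover have "Re ((?E (Q 0) *\<^sub>v s) \<bullet>c s) \<ge> 0"
    using sos_mats_nonneg[OF Q s, of 0 \<alpha>] by simp
  moreover have "(\<Sum>l\<in>{1..L}. eval_mpoly \<alpha> (q l) * Re ((?E (Q l) *\<^sub>v s) \<bullet>c s)) \<ge> 0"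
    using sos_mats_nonneg[OF Q s] q by (intro sum_nonneg mult_nonneg_nonneg) auto
  ultimately show ?thesis by linarith
qed

section \<open>The error system\<close>

lemma brl_mat_carrier:
  assumes "A \<in> carrier_mat n n" "B \<in> carrier_mat n m" "C \<in> carrier_mat k n" "D \<in> carrier_mat k m"
    "P \<in> carrier_mat n n"
  shows "brl_mat P A B C D g n m k \<in> carrier_mat ((n + n) + (m + k)) ((n + n) + (m + k))"
  unfolding brl_mat_def using assms by (intro four_block_carrier_mat) auto

text \<open>All blocks are built by ring operations and transposition, which evaluation
  respects.\<close>

lemma eval_cmat_brl_mat:
  assumes A: "A \<in> carrier_mat n n" and B: "B \<in> carrier_mat n m"
    and C: "C \<in> carrier_mat k n" and D: "D \<in> carrier_mat k m" and P: "P \<in> carrier_mat n n"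
  shows "eval_cmat \<alpha> (brl_mat P A B C D (Const g) n m k) =
    brl_mat (eval_cmat \<alpha> P) (eval_cmat \<alpha> A) (eval_cmat \<alpha> B) (eval_cmat \<alpha> C) (eval_cmat \<alpha> D)
      (complex_of_real g) n m k"
proof -
  note carr = assms transpose_carrier_mat[THEN iffD2, OF A] transpose_carrier_mat[THEN iffD2, OF B]
    transpose_carrier_mat[THEN iffD2, OF C] transpose_carrier_mat[THEN iffD2, OF D]
  note sub = eval_cmat_four_block[of _ n n _ n _ n] eval_cmat_four_block[of _ n m _ k _ n]
    eval_cmat_four_block[of _ m n _ n _ k] eval_cmat_four_block[of _ m m _ k _ k]
  show ?thesis
    unfolding brl_mat_def
    by (subst eval_cmat_four_block[of _ "n + n" "n + n" _ "m + k" _ "m + k"])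
      (use carr in \<open>simp_all add: sub eval_cmat_transpose eval_cmat_zero eval_cmat_one
        eval_cmat_smult_Const eval_cmat_mult[of _ n n _ n] eval_cmat_mult[of _ n n _ k] eval_cmat_mult[of _ k n _ n]\<close>)
qed

text \<open>Columns are appended by transposing appended rows. Read as a block matrix whose lower
  blocks have no rows, the result can be multiplied blockwise.\<close>

lemma append_cols_mult_vec:
  fixes A B :: "complex mat"
  assumes A: "A \<in> carrier_mat k n" and B: "B \<in> carrier_mat k n'"
    and x: "x \<in> carrier_vec n" and y: "y \<in> carrier_vec n'"
  shows "transpose_mat (transpose_mat A @\<^sub>r transpose_mat B) *\<^sub>v (x @\<^sub>v y) = A *\<^sub>v x + B *\<^sub>v y"
proof -
  have "transpose_mat (transpose_mat A @\<^sub>r transpose_mat B) =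
      four_block_mat A B (0\<^sub>m 0 n) (0\<^sub>m 0 n')"
    unfolding append_rows_def using A B
    by (subst transpose_four_block_mat[of _ n k _ 0 _ n']) auto
  also have "\<dots> *\<^sub>v (x @\<^sub>v y) = A *\<^sub>v x + B *\<^sub>v y"
    using A B x y by (subst four_block_mat_mult_vec[of _ k n _ n' _ 0]) auto
  finally show ?thesis .
qed

theorem theorem3p7:
  fixes n n' m o' p p' L :: nat
    and A B C D A' B' C' D' At Bt Ct Dt :: "mpoly mat"
    and q w :: "nat \<Rightarrow> mpoly"
    and \<A> :: "(nat \<Rightarrow> real) set"
    and \<gamma> :: real
    and G G' :: "complex \<Rightarrow> (nat \<Rightarrow> real) \<Rightarrow> complex mat"
  assumes A: "A \<in> poly_mats p n n" and B: "B \<in> poly_mats p n m"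
    and C: "C \<in> poly_mats p o' n" and D: "D \<in> poly_mats p o' m"
    and G: "\<And>z \<alpha>. G z \<alpha> =
      transfer_fun (eval_cmat \<alpha> A) (eval_cmat \<alpha> B) (eval_cmat \<alpha> C) (eval_cmat \<alpha> D) z"
    and q: "\<And>l. l \<in> {1..L} \<Longrightarrow> q l \<in> polys p"
    and \<A>: "\<A> = {\<alpha> \<in> topspace (Euclidean_space p). \<forall>l\<in>{1..L}. eval_mpoly \<alpha> (q l) \<ge> 0}"
    and compact_\<A>: "compactin (Euclidean_space p) \<A>"
    and w: "\<And>l. l \<in> {0..L} \<Longrightarrow> w l \<in> sos p"
    and compact_w: "compactin (Euclidean_space p)
      {\<alpha> \<in> topspace (Euclidean_space p).
         eval_mpoly \<alpha> (w 0) + (\<Sum>l=1..L. eval_mpoly \<alpha> (q l) * eval_mpoly \<alpha> (w l)) \<ge> 0}"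
    and \<gamma>: "\<gamma> \<ge> 0"
    and p': "p' \<le> p"
    and A': "A' \<in> poly_mats p' n' n'" and B': "B' \<in> poly_mats p' n' m"
    and C': "C' \<in> poly_mats p' o' n'" and D': "D' \<in> poly_mats p' o' m"
    and G': "\<And>z \<alpha>'. G' z \<alpha>' =
      transfer_fun (eval_cmat \<alpha>' A') (eval_cmat \<alpha>' B') (eval_cmat \<alpha>' C') (eval_cmat \<alpha>' D') z"
    and At: "At = four_block_mat A (0\<^sub>m n n') (0\<^sub>m n' n) A'"
    and Bt: "Bt = B @\<^sub>r B'"
    and Ct: "Ct = transpose_mat (transpose_mat C @\<^sub>r transpose_mat (- C'))"
    and Dt: "Dt = D - D'"
    and certificate: "\<exists>\<epsilon>>0. \<exists>P\<in>sos_mats p (n + n'). \<exists>Q.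
      (\<forall>l\<in>{0..L}. Q l \<in> sos_mats p (2 * (n + n') + m + o')) \<and>
      four_block_mat
        (four_block_mat
           P                                    (At * P)
           (P * transpose_mat At)               P)
        (four_block_mat
           Bt                                   (0\<^sub>m (n + n') o')
           (0\<^sub>m (n + n') m)                      (P * transpose_mat Ct))
        (four_block_mat
           (transpose_mat Bt)                   (0\<^sub>m m (n + n'))
           (0\<^sub>m o' (n + n'))                     (Ct * P))
        (four_block_mat
           (1\<^sub>m m)                               (transpose_mat Dt)
           Dt                                   (Const (\<gamma>\<^sup>2) \<cdot>\<^sub>m 1\<^sub>m o'))
      - Const \<epsilon> \<cdot>\<^sub>m 1\<^sub>m (2 * (n + n') + m + o')
      - Q 0
      - mat_sum (2 * (n + n') + m + o') (2 * (n + n') + m + o') (\<lambda>l. q l \<cdot>\<^sub>m Q l) {1..L}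
      = 0\<^sub>m (2 * (n + n') + m + o') (2 * (n + n') + m + o')"
  shows "\<forall>\<alpha>\<in>\<A>.
    hinf_norm (spectrum (eval_cmat \<alpha> A) \<union> spectrum (eval_cmat (trunc p' \<alpha>) A'))
      (\<lambda>z. G z \<alpha> - G' z (trunc p' \<alpha>)) \<le> ereal \<gamma>"
proof
  fix \<alpha> assume \<alpha>: "\<alpha> \<in> \<A>"
  let ?N = "n + n'"
  let ?M = "2 * (n + n') + m + o'"
  let ?E = "\<lambda>M. eval_cmat \<alpha> M"
  \<comment> \<open>The dimension regrouped along the outer block splitting, as
    \<open>brl_mat_carrier\<close> yields it.\<close>
  have M: "?M = (?N + ?N) + (m + o')" by simp
  note carr = A[THEN poly_mats_carrier] B[THEN poly_mats_carrier] C[THEN poly_mats_carrier]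
    D[THEN poly_mats_carrier] A'[THEN poly_mats_carrier] B'[THEN poly_mats_carrier]
    C'[THEN poly_mats_carrier] D'[THEN poly_mats_carrier]
  have Atc: "At \<in> carrier_mat ?N ?N" and Btc: "Bt \<in> carrier_mat ?N m"
    and Ctc: "Ct \<in> carrier_mat o' ?N" and Dtc: "Dt \<in> carrier_mat o' m"
    using carr by (auto simp: At Bt Ct Dt)
  obtain \<epsilon> P Q where \<epsilon>: "\<epsilon> > 0" and P: "P \<in> sos_mats p ?N"
    and Q: "\<And>l. l \<in> {0..L} \<Longrightarrow> Q l \<in> sos_mats p ?M"
    and cert: "brl_mat P At Bt Ct Dt (Const (\<gamma>\<^sup>2)) ?N m o' - Const \<epsilon> \<cdot>\<^sub>m 1\<^sub>m ?M - Q 0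
      - mat_sum ?M ?M (\<lambda>l. q l \<cdot>\<^sub>m Q l) {1..L} = 0\<^sub>m ?M ?M"
    using certificate unfolding brl_mat_def by blast
  have Pc: "P \<in> carrier_mat ?N ?N" using P by (rule sos_mats_carrier)
  \<comment> \<open>Membership of \<open>\<alpha>\<close> in \<open>\<A>\<close> enters here, as
    nonnegativity of the \<open>q l\<close> at \<open>\<alpha>\<close>.\<close>
  have lmi: "\<epsilon> * Re (s \<bullet>c s) \<le> Re ((brl_mat (?E P) (?E At) (?E Bt) (?E Ct) (?E Dt)
      (complex_of_real (\<gamma>\<^sup>2)) ?N m o' *\<^sub>v s) \<bullet>c s)"
    if "s \<in> carrier_vec ((?N + ?N) + (m + o'))" for s
    using sos_certificate_lower_bound[OF _ cert Q, where \<alpha> = \<alpha> and s = s] brl_mat_carrier[OF Atc Btc Ctc Dtc Pc]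
      that \<alpha> unfolding eval_cmat_brl_mat[OF Atc Btc Ctc Dtc Pc] M \<A> by blast
  have Psym: "transpose_mat (?E P) = ?E P"
    using sos_mats_transpose[OF P] by (simp flip: eval_cmat_transpose)
  have "largest_singular_value (G z \<alpha> - G' z (trunc p' \<alpha>)) \<le> \<gamma>"
    if z: "cmod z > 1" "z \<notin> spectrum (?E A)" "z \<notin> spectrum (eval_cmat (trunc p' \<alpha>) A')" for z
  proof -
    have G'z: "G' z (trunc p' \<alpha>) = transfer_fun (?E A') (?E B') (?E C') (?E D') z"
      by (simp add: G' eval_cmat_trunc[OF A'] eval_cmat_trunc[OF B'] eval_cmat_trunc[OF C']
          eval_cmat_trunc[OF D'])
    have z': "z \<notin> spectrum (?E A')" using z(3) by (simp add: eval_cmat_trunc[OF A'])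
    note ecarr = carr[THEN eval_cmat_carrier[THEN iffD2], of \<alpha>]
    note st = transfer_fun_state[OF ecarr(1-4) z(2)] and st' = transfer_fun_state[OF ecarr(5-8) z']
    \<comment> \<open>The zero input is a dummy; only the dimension claim is extracted.\<close>
    have Gc: "G z \<alpha> \<in> carrier_mat o' m" and G'c: "G' z (trunc p' \<alpha>) \<in> carrier_mat o' m"
      using st[of "0\<^sub>v m"] st'[of "0\<^sub>v m"] unfolding G G'z by auto
    show ?thesis
    proof (rule largest_singular_value_le[OF _ \<gamma>])
      show "G z \<alpha> - G' z (trunc p' \<alpha>) \<in> carrier_mat o' m" using G'c by auto
      fix u :: "complex vec" assume u: "u \<in> carrier_vec m"
      obtain x where x: "x \<in> carrier_vec n" "z \<cdot>\<^sub>v x = ?E A *\<^sub>v x + ?E B *\<^sub>v u"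
        and Gx: "G z \<alpha> *\<^sub>v u = ?E C *\<^sub>v x + ?E D *\<^sub>v u"
        using st[OF u] unfolding G by metis
      obtain x' where x': "x' \<in> carrier_vec n'" "z \<cdot>\<^sub>v x' = ?E A' *\<^sub>v x' + ?E B' *\<^sub>v u"
        and Gx': "G' z (trunc p' \<alpha>) *\<^sub>v u = ?E C' *\<^sub>v x' + ?E D' *\<^sub>v u"
        using st'[OF u] unfolding G'z by metis
      have A_x: "?E At *\<^sub>v (x @\<^sub>v x') = (?E A *\<^sub>v x) @\<^sub>v (?E A' *\<^sub>v x')"
        unfolding At using carr x(1) x'(1)
        by (subst eval_cmat_four_block[of _ n n _ n' _ n'])
          (auto simp: four_block_mat_mult_vec[of _ n n _ n' _ n'] eval_cmat_zero)
      have B_u: "?E Bt *\<^sub>v u = (?E B *\<^sub>v u) @\<^sub>v (?E B' *\<^sub>v u)"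
        unfolding Bt eval_cmat_append_rows[OF carr(2,6)] using mat_mult_append[OF ecarr(2,6) u] .
      \<comment> \<open>Both systems receive the same input \<open>u\<close>, so the stacked states
        solve the state equation of the error system.\<close>
      have state: "z \<cdot>\<^sub>v (x @\<^sub>v x') = ?E At *\<^sub>v (x @\<^sub>v x') + ?E Bt *\<^sub>v u"
      proof -
        have Ax: "?E A *\<^sub>v x \<in> carrier_vec n" "?E B *\<^sub>v u \<in> carrier_vec n"
          "?E A' *\<^sub>v x' \<in> carrier_vec n'" "?E B' *\<^sub>v u \<in> carrier_vec n'"
          using ecarr x(1) x'(1) u by (auto intro!: mult_mat_vec_carrier)
        have "z \<cdot>\<^sub>v (x @\<^sub>v x') = (z \<cdot>\<^sub>v x) @\<^sub>v (z \<cdot>\<^sub>v x')"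
          by (intro eq_vecI) auto
        also have "\<dots> = ?E At *\<^sub>v (x @\<^sub>v x') + ?E Bt *\<^sub>v u"
          unfolding A_x B_u x(2) x'(2) by (rule append_vec_add[symmetric, OF Ax])
        finally show ?thesis .
      qed
      have C_x: "?E Ct *\<^sub>v (x @\<^sub>v x') = ?E C *\<^sub>v x + (- ?E C') *\<^sub>v x'"
      proof -
        have "?E Ct = transpose_mat (transpose_mat (?E C) @\<^sub>r transpose_mat (- ?E C'))"
          unfolding Ct using carr
          by (simp add: eval_cmat_transpose eval_cmat_uminus eval_cmat_append_rows[of _ n o' _ n'])
        then show ?thesis
          using append_cols_mult_vec[of "?E C" o' n "- ?E C'" n' x x'] ecarr x x' by simp
      qed
      \<comment> \<open>The minus signs in \<open>Ct\<close> and \<open>Dt\<close> make the output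
        of the error system the difference of the two outputs.\<close>
      have "(G z \<alpha> - G' z (trunc p' \<alpha>)) *\<^sub>v u = ?E Ct *\<^sub>v (x @\<^sub>v x') + ?E Dt *\<^sub>v u"
        unfolding minus_mult_distrib_mat_vec[OF Gc G'c u] Gx Gx' C_x Dt eval_cmat_minus[OF carr(4,8)]
          minus_mult_distrib_mat_vec[OF ecarr(4,8) u]
        using ecarr u x(1) x'(1) by (intro eq_vecI) auto
      then show "Re (((G z \<alpha> - G' z (trunc p' \<alpha>)) *\<^sub>v u) \<bullet>c ((G z \<alpha> - G' z (trunc p' \<alpha>)) *\<^sub>v u))
          \<le> \<gamma>\<^sup>2 * Re (u \<bullet>c u)"
        using bounded_real[OF _ _ _ _ _ _ _ _ _ _ Psym \<epsilon> lmi z(1) _ u state] Atc Btc Ctc Dtc Pc x(1) x'(1)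
        by (simp add: real_cmat_eval_cmat)
    qed
  qed
  then show "hinf_norm (spectrum (?E A) \<union> spectrum (eval_cmat (trunc p' \<alpha>) A'))
      (\<lambda>z. G z \<alpha> - G' z (trunc p' \<alpha>)) \<le> ereal \<gamma>"
    unfolding hinf_norm_def by (intro SUP_least) auto
qed

end
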